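(* For every integer $n\ge 3$, the threshold bias of the $(1:q)$ Budget Triangle Game on $K_n$ is exactly $$q_\triangle^b(n)=\left\lceil\sqrt{2n-2}-\frac{3}{2}\right\rceil .$$
   Context: For an integer $n\ge 3$ and a non-negative integer $q$ (the bias), the $(1:q)$ Budget Triangle Game on the complete graph $K_n$ is played by two players, Maker and Breaker, who take alternate turns, with Maker beginning. In her turn, Maker claims one previously unclaimed edge of $K_n$. In his turn, Breaker may claim an arbitrary number (possibly zero) of previously unclaimed edges of $K_n$, subject to the condition that at the end of his turn the total number of edges claimed by Breaker so far is at most $q$ times the total number of edges claimed by Maker so far. Maker wins if at some point she has claimed all three edges of a triangle of $K_n$. Breaker wins if he manages to claim at least one edge of each triangle of $K_n$. The threshold bias $q_\triangle^b(n)$ is the smallest non-negative integer $q$ such that Breaker has a winning strategy in this game. *)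

theory Defs
  imports Complex_Main "HOL-Library.Ramsey"
begin

text \<open>The vertices of \<open>K\<^sub>n\<close> are \<open>{..<n}\<close>; an edge is a two-element set of vertices. A round is
  Maker's edge together with the set of edges that Breaker claims in response, and a history is
  the list of completed rounds in chronological order.\<close>

type_synonym edge = "nat set"
type_synonym history = "(edge \<times> edge set) list"

abbreviation K_edges :: "nat \<Rightarrow> edge set" where
  "K_edges n \<equiv> [{..<n}]\<^bsup>2\<^esup>"

text \<open>A triangle is given by its three vertices \<open>T\<close>; its edges are \<open>[T]\<^bsup>2\<^esup>\<close>.\<close>

abbreviation K_triangles :: "nat \<Rightarrow> nat set set" where
  "K_triangles n \<equiv> [{..<n}]\<^bsup>3\<^esup>"

definition maker_edges :: "history \<Rightarrow> edge set" where
  "maker_edges h = fst ` set h"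

definition breaker_edges :: "history \<Rightarrow> edge set" where
  "breaker_edges h = \<Union> (snd ` set h)"

definition unclaimed :: "nat \<Rightarrow> history \<Rightarrow> edge set" where
  "unclaimed n h = K_edges n - maker_edges h - breaker_edges h"

text \<open>\<open>S\<close> is a legal turn of Breaker after the completed rounds \<open>h\<close> and Maker's new edge \<open>e\<close>.\<close>

definition legal_reply :: "nat \<Rightarrow> nat \<Rightarrow> history \<Rightarrow> edge \<Rightarrow> edge set \<Rightarrow> bool" where
  "legal_reply n q h e S \<longleftrightarrow>
     S \<subseteq> unclaimed n h - {e} \<and>
     card (breaker_edges h \<union> S) \<le> q * card (insert e (maker_edges h))"

inductive legal_play :: "nat \<Rightarrow> nat \<Rightarrow> history \<Rightarrow> bool" for n q where
  start: "legal_play n q []"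
| round: "legal_play n q h \<Longrightarrow> e \<in> unclaimed n h \<Longrightarrow> legal_reply n q h e S
            \<Longrightarrow> legal_play n q (h @ [(e, S)])"

text \<open>Play continues until every edge is claimed. Stopping as soon as a player has won would not
  change the outcome: once Maker owns a triangle Breaker can never meet it, and once Breaker meets
  every triangle Maker can never own one.\<close>

definition breaker_wins :: "nat \<Rightarrow> history \<Rightarrow> bool" where
  "breaker_wins n h \<longleftrightarrow> (\<forall>T \<in> K_triangles n. [T]\<^bsup>2\<^esup> \<inter> breaker_edges h \<noteq> {})"

definition maker_wins :: "nat \<Rightarrow> history \<Rightarrow> bool" where
  "maker_wins n h \<longleftrightarrow> (\<exists>T \<in> K_triangles n. [T]\<^bsup>2\<^esup> \<subseteq> maker_edges h)"

type_synonym strategy = "history \<Rightarrow> edge \<Rightarrow> edge set"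

definition breaker_strategy :: "nat \<Rightarrow> nat \<Rightarrow> strategy \<Rightarrow> bool" where
  "breaker_strategy n q \<sigma> \<longleftrightarrow>
     (\<forall>h e. legal_play n q h \<longrightarrow> e \<in> unclaimed n h \<longrightarrow> legal_reply n q h e (\<sigma> h e))"

definition follows :: "strategy \<Rightarrow> history \<Rightarrow> bool" where
  "follows \<sigma> h \<longleftrightarrow> (\<forall>i < length h. snd (h ! i) = \<sigma> (take i h) (fst (h ! i)))"

definition breaker_has_winning_strategy :: "nat \<Rightarrow> nat \<Rightarrow> bool" where
  "breaker_has_winning_strategy n q \<longleftrightarrow>
     (\<exists>\<sigma>. breaker_strategy n q \<sigma> \<and>
       (\<forall>h. legal_play n q h \<longrightarrow> follows \<sigma> h \<longrightarrow> unclaimed n h = {} \<longrightarrow> breaker_wins n h))"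

definition threshold_bias :: "nat \<Rightarrow> nat" where
  "threshold_bias n = (LEAST q. breaker_has_winning_strategy n q)"

lemma legal_play_disjoint:
  "legal_play n q h \<Longrightarrow> maker_edges h \<inter> breaker_edges h = {}"
  by (induction rule: legal_play.induct)
     (auto simp: maker_edges_def breaker_edges_def unclaimed_def legal_reply_def)

lemma legal_play_subset:
  "legal_play n q h \<Longrightarrow> maker_edges h \<subseteq> K_edges n \<and> breaker_edges h \<subseteq> K_edges n"
  by (induction rule: legal_play.induct)
     (auto simp: maker_edges_def breaker_edges_def unclaimed_def legal_reply_def)

text \<open>At the end of a play exactly one player has won.\<close>

lemma breaker_wins_iff_not_maker_wins:
  assumes "legal_play n q h" and "unclaimed n h = {}"
  shows "breaker_wins n h \<longleftrightarrow> \<not> maker_wins n h"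
proof -
  have "[T]\<^bsup>2\<^esup> \<inter> breaker_edges h \<noteq> {} \<longleftrightarrow> \<not> [T]\<^bsup>2\<^esup> \<subseteq> maker_edges h"
    if "T \<in> K_triangles n" for T
  proof -
    have "T \<subseteq> {..<n}" using that by (auto simp: nsets_def)
    then have "[T]\<^bsup>2\<^esup> \<subseteq> K_edges n" by (rule nsets_mono)
    then show ?thesis
      using legal_play_disjoint[OF assms(1)] assms(2) unfolding unclaimed_def by blast
  qed
  then show ?thesis unfolding breaker_wins_def maker_wins_def by blast
qed

text \<open>With bias \<open>card (K_edges n)\<close> Breaker can claim everything in his first turn, so the minimum
  in the definition of \<open>threshold_bias\<close> is attained.\<close>

lemma breaker_has_winning_strategy_large_bias:
  "breaker_has_winning_strategy n (card (K_edges n))"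
proof -
  define q where "q = card (K_edges n)"
  define \<sigma> :: strategy where "\<sigma> h e = unclaimed n h - {e}" for h e
  have fin: "finite (K_edges n)" by (simp add: finite_imp_finite_nsets)
  have leg: "breaker_strategy n q \<sigma>"
    unfolding breaker_strategy_def
  proof (intro allI impI)
    fix h e
    assume h: "legal_play n q h" and e: "e \<in> unclaimed n h"
    have sub: "maker_edges h \<subseteq> K_edges n" "breaker_edges h \<subseteq> K_edges n"
      using legal_play_subset[OF h] by auto
    have "card (breaker_edges h \<union> \<sigma> h e) \<le> card (K_edges n)"
      using sub fin by (intro card_mono) (auto simp: \<sigma>_def unclaimed_def)
    moreover have "card (insert e (maker_edges h)) \<ge> 1"
      using finite_subset[OF sub(1) fin] by (simp add: Suc_leI card_gt_0_iff)
    ultimately have "card (breaker_edges h \<union> \<sigma> h e) \<le> q * card (insert e (maker_edges h))"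
      unfolding q_def by (metis mult.right_neutral mult_le_mono2 order_trans)
    then show "legal_reply n q h e (\<sigma> h e)"
      unfolding legal_reply_def by (simp add: \<sigma>_def)
  qed
  have one: "follows \<sigma> h \<longrightarrow> card (maker_edges h) \<le> 1 \<and> (h \<noteq> [] \<longrightarrow> unclaimed n h = {})"
    if "legal_play n q h" for h
    using that
  proof (induction rule: legal_play.induct)
    case start
    show ?case by (simp add: maker_edges_def)
  next
    case (round h e S)
    show ?case
    proof
      assume f: "follows \<sigma> (h @ [(e, S)])"
      have "follows \<sigma> h"
        unfolding follows_def
      proof (intro allI impI)
        fix i assume "i < length h"
        then show "snd (h ! i) = \<sigma> (take i h) (fst (h ! i))"
          using f[unfolded follows_def, rule_format, of i] by (simp add: nth_append)
      qed
      then have "h = []" using round by auto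
      moreover have "S = \<sigma> h e"
        using f[unfolded follows_def, rule_format, of "length h"] by simp
      ultimately show "card (maker_edges (h @ [(e, S)])) \<le> 1 \<and>
          (h @ [(e, S)] \<noteq> [] \<longrightarrow> unclaimed n (h @ [(e, S)]) = {})"
        by (auto simp: maker_edges_def breaker_edges_def unclaimed_def \<sigma>_def)
    qed
  qed
  have "breaker_wins n h"
    if h: "legal_play n q h" "follows \<sigma> h" "unclaimed n h = {}" for h
  proof -
    have "\<not> maker_wins n h"
    proof
      assume "maker_wins n h"
      then obtain T where T: "T \<in> K_triangles n" "[T]\<^bsup>2\<^esup> \<subseteq> maker_edges h"
        unfolding maker_wins_def by blast
      have "finite (maker_edges h)"
        using legal_play_subset[OF h(1)] fin finite_subset by blast
      then have "card ([T]\<^bsup>2\<^esup>) \<le> 1"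
        using card_mono[OF _ T(2)] one[OF h(1)] h(2) by auto
      moreover have "card ([T]\<^bsup>2\<^esup>) = card T choose 2"
        using T(1) by (simp add: card_nsets nsets_def[of "{..<n}"])
      ultimately show False using T(1) by (simp add: nsets_def choose_two)
    qed
    then show ?thesis using breaker_wins_iff_not_maker_wins[OF h(1,3)] by blast
  qed
  with leg show ?thesis unfolding breaker_has_winning_strategy_def q_def by blast
qed

end

theory Submission
  imports Defs
begin

text \<open>Breaker wins iff \<open>n - 1 \<le> (q + 2) choose 2\<close>. If this fails, Maker keeps adding edges to
  a star at one vertex and closes a triangle whenever she can. When the star can no longer grow, with
  \<open>d\<close> rays say, Breaker owns all pairs of its leaves and all other edges at the centre, so that
  \<open>(d choose 2) + (n - 1 - d) \<le> q d\<close>, which forces \<open>n - 1 \<le> (q + 2) choose 2\<close>.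
  Conversely, Breaker always owns exactly the pairs that have a common Maker neighbour, or an endpoint
  of Maker degree \<open>q + 1\<close> (a saturated vertex). Every Maker edge gives \<open>q / 2\<close>
  to each of its ends. A saturated vertex pays for its at most \<open>(q + 1) choose 2\<close> Breaker edges
  with its own shares; the pairs of unsaturated Maker neighbours of a vertex \<open>c\<close> are paid for by these
  neighbours' shares of their edges to \<open>c\<close>, which suffices because \<open>c\<close> has degree at most \<open>q + 1\<close>.\<close>

section \<open>Neighbourhoods\<close>

definition nbhd :: "edge set \<Rightarrow> nat \<Rightarrow> nat set" where
  "nbhd E v = {w. {v, w} \<in> E}"

lemma in_nbhd_commute: "v \<in> nbhd E w \<longleftrightarrow> w \<in> nbhd E v"
  by (simp add: nbhd_def insert_commute)

lemma nbhd_subset: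
  assumes "E \<subseteq> K_edges n"
  shows "nbhd E v \<subseteq> {..<n} - {v}"
proof
  fix w assume "w \<in> nbhd E v"
  then have "{v, w} \<in> K_edges n" using assms unfolding nbhd_def by blast
  then show "w \<in> {..<n} - {v}" by auto
qed

lemma finite_nbhd: "E \<subseteq> K_edges n \<Longrightarrow> finite (nbhd E v)"
  by (rule finite_subset[OF nbhd_subset]) auto

lemma finite_K_edges: "finite (K_edges n)"
  by (simp add: finite_imp_finite_nsets)

lemma two_times_choose_two: "2 * (k choose 2) = k * (k - 1)"
  by (cases k) (simp_all add: choose_two)

lemma card_incident_edges:
  assumes "E \<subseteq> K_edges n"
  shows "card {e \<in> E. v \<in> e} = card (nbhd E v)"
proof -
  have "inj_on (\<lambda>w. {v, w}) (nbhd E v)"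
    by (auto simp: inj_on_def doubleton_eq_iff)
  moreover have "{e \<in> E. v \<in> e} = (\<lambda>w. {v, w}) ` nbhd E v"
    using assms by (fastforce simp: nbhd_def insert_commute elim!: nsets2_E)
  ultimately show ?thesis by (metis card_image)
qed

lemma card_K_edges_at:
  assumes "v < n"
  shows "card {e \<in> K_edges n. v \<in> e} = n - 1"
proof -
  have "nbhd (K_edges n) v = {..<n} - {v}"
    using assms by (auto simp: nbhd_def)
  then show ?thesis using card_incident_edges[of "K_edges n" n v] assms by simp
qed

text \<open>Handshake lemma: incidences of vertices and edges are counted in two ways.\<close>

lemma sum_card_nbhd:
  assumes "E \<subseteq> K_edges n"
  shows "(\<Sum>v<n. card (nbhd E v)) = 2 * card E"
proof -
  have "card {v \<in> {..<n}. v \<in> e} = 2" if "e \<in> E" for e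
  proof -
    have "{v \<in> {..<n}. v \<in> e} = e" "card e = 2"
      using assms that by (auto simp: nsets_def)
    then show ?thesis by simp
  qed
  moreover have "finite E" using assms finite_K_edges by (rule finite_subset)
  ultimately have "(\<Sum>v<n. card {e \<in> E. v \<in> e}) = 2 * card E"
    by (intro sum_multicount) auto
  then show ?thesis using card_incident_edges[OF assms] by simp
qed

section \<open>Breaker's strategy\<close>

text \<open>The first alternative caps Maker's degrees at \<open>q + 1\<close>; the second covers
  the edges that would close a triangle at once. The set depends on Maker's edges alone, so it can
  be Breaker's target in every position.\<close>

definition blocked :: "nat \<Rightarrow> nat \<Rightarrow> edge set \<Rightarrow> edge set" where
  "blocked n q E = {f \<in> K_edges n - E. (\<exists>v\<in>f. q < card (nbhd E v)) \<or> (\<exists>c. f \<subseteq> nbhd E c)}"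

text \<open>The charging argument with everything doubled, so that the shares \<open>q / 2\<close>
  stay integral.\<close>

lemma card_blocked_le:
  assumes E: "E \<subseteq> K_edges n"
    and deg: "\<And>v. card (nbhd E v) \<le> Suc q"
    and n: "n - 1 \<le> (q + 2) choose 2"
  shows "card (blocked n q E) \<le> q * card E"
proof -
  define S where "S = {v \<in> {..<n}. q < card (nbhd E v)}"
  define U where "U = {..<n} - S"
  define A where "A = (\<lambda>v. {f \<in> K_edges n - E. v \<in> f})"
  have fin: "finite S" "finite U" by (auto simp: S_def U_def)
  have degS: "card (nbhd E v) = Suc q" if "v \<in> S" for v
    using that deg[of v] by (simp add: S_def)
  have A: "2 * card (A v) \<le> q * card (nbhd E v)" if v: "v \<in> S" for v
  proof -
    have "A v = {e \<in> K_edges n. v \<in> e} - {e \<in> E. v \<in> e}"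
      by (auto simp: A_def)
    moreover have "finite {e \<in> E. v \<in> e}"
      using E finite_K_edges finite_subset by fastforce
    moreover have "{e \<in> E. v \<in> e} \<subseteq> {e \<in> K_edges n. v \<in> e}"
      using E by auto
    ultimately have "card (A v) = card {e \<in> K_edges n. v \<in> e} - card {e \<in> E. v \<in> e}"
      by (metis card_Diff_subset)
    also have "\<dots> = n - 1 - Suc q"
      using card_K_edges_at[of v n] card_incident_edges[OF E, of v] degS[OF v] v
      by (simp add: S_def)
    \<comment> \<open>Pascal's rule splits \<open>(q + 2) choose 2\<close> into \<open>Suc q\<close>
      and \<open>Suc q choose 2\<close>; the first part cancels against the degree of
      \<open>v\<close>.\<close>
    also have "\<dots> \<le> Suc q choose 2"
      using n by (simp add: numeral_2_eq_2)
    finally have "2 * card (A v) \<le> 2 * (Suc q choose 2)" by simp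
    also have "\<dots> = Suc q * q"
      by (simp add: two_times_choose_two)
    finally show ?thesis using degS[OF v] by (simp add: mult.commute)
  qed
  \<comment> \<open>For \<open>k\<close> unsaturated neighbours the left side is
    \<open>k * (k - 1)\<close>, and the degree bound gives \<open>k - 1 \<le> q\<close>.\<close>
  have B: "2 * card ([nbhd E c \<inter> U]\<^bsup>2\<^esup>) \<le> q * card (nbhd E c \<inter> U)" for c
  proof -
    have "card (nbhd E c \<inter> U) \<le> Suc q"
      using card_mono[OF finite_nbhd[OF E], of "nbhd E c \<inter> U" c] deg[of c] by simp
    then have "card (nbhd E c \<inter> U) - 1 \<le> q" by simp
    then show ?thesis
      by (simp add: card_nsets two_times_choose_two mult.commute)
  qed
  have "blocked n q E \<subseteq> (\<Union>v\<in>S. A v) \<union> (\<Union>c<n. [nbhd E c \<inter> U]\<^bsup>2\<^esup>)"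
  proof
    fix f assume f: "f \<in> blocked n q E"
    then have f2: "f \<subseteq> {..<n}" "f \<in> K_edges n - E" "finite f" "card f = 2"
      by (auto simp: blocked_def nsets_def)
    show "f \<in> (\<Union>v\<in>S. A v) \<union> (\<Union>c<n. [nbhd E c \<inter> U]\<^bsup>2\<^esup>)"
    proof (cases "f \<inter> S = {}")
      case True
      then obtain c where c: "f \<subseteq> nbhd E c"
        using f f2(1) by (auto simp: blocked_def S_def)
      \<comment> \<open>\<open>blocked\<close> puts no bound on \<open>c\<close>, but
        \<open>c\<close> is adjacent to an end of \<open>f\<close> and hence a vertex.\<close>
      moreover obtain w where "w \<in> f" using f2(4) by fastforce
      ultimately have "c \<in> nbhd E w" using in_nbhd_commute by blast
      then have "c < n" using nbhd_subset[OF E] by blast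
      moreover have "f \<in> [nbhd E c \<inter> U]\<^bsup>2\<^esup>"
        using c f2 True by (auto simp: nsets_def U_def)
      ultimately show ?thesis by blast
    qed (use f2 in \<open>auto simp: A_def\<close>)
  qed
  then have "card (blocked n q E) \<le> card ((\<Union>v\<in>S. A v) \<union> (\<Union>c<n. [nbhd E c \<inter> U]\<^bsup>2\<^esup>))"
    using fin by (intro card_mono) (auto simp: A_def finite_K_edges finite_imp_finite_nsets)
  also have "\<dots> \<le> card (\<Union>v\<in>S. A v) + card (\<Union>c<n. [nbhd E c \<inter> U]\<^bsup>2\<^esup>)"
    by (rule card_Un_le)
  also have "\<dots> \<le> (\<Sum>v\<in>S. card (A v)) + (\<Sum>c<n. card ([nbhd E c \<inter> U]\<^bsup>2\<^esup>))"
    using fin by (intro add_mono card_UN_le) auto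
  finally have "2 * card (blocked n q E)
      \<le> (\<Sum>v\<in>S. 2 * card (A v)) + (\<Sum>c<n. 2 * card ([nbhd E c \<inter> U]\<^bsup>2\<^esup>))"
    by (simp flip: sum_distrib_left)
  also have "\<dots> \<le> (\<Sum>v\<in>S. q * card (nbhd E v)) + (\<Sum>c<n. q * card (nbhd E c \<inter> U))"
    using A B by (intro add_mono sum_mono) auto
  \<comment> \<open>Adjacency is symmetric: what the centres \<open>c\<close> receive is what the
    unsaturated vertices \<open>w\<close> pay along all their edges.\<close>
  also have "(\<Sum>c<n. q * card (nbhd E c \<inter> U)) = (\<Sum>w\<in>U. q * card (nbhd E w))"
  proof -
    have "{c \<in> {..<n}. w \<in> nbhd E c} = nbhd E w" for w
      using nbhd_subset[OF E] in_nbhd_commute by blast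
    then have "(\<Sum>c<n. card {w \<in> U. w \<in> nbhd E c}) = (\<Sum>w\<in>U. card (nbhd E w))"
      using fin by (intro sum_multicount_gen) auto
    moreover have "{w \<in> U. w \<in> nbhd E c} = nbhd E c \<inter> U" for c by auto
    ultimately show ?thesis by (simp flip: sum_distrib_left)
  qed
  also have "(\<Sum>v\<in>S. q * card (nbhd E v)) + (\<Sum>w\<in>U. q * card (nbhd E w))
      = (\<Sum>v<n. q * card (nbhd E v))"
    unfolding U_def by (subst sum.subset_diff[of S "{..<n}"]) (auto simp: S_def)
  also have "\<dots> = 2 * (q * card E)"
    using sum_card_nbhd[OF E] by (simp flip: sum_distrib_left)
  finally show ?thesis by simp
qed

text \<open>New Maker edges only enlarge neighbourhoods, so both reasons for being blocked persist.
  Thus a Breaker who owns exactly the blocked edges holds nothing outside his next target.\<close>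

lemma blocked_mono:
  assumes "E \<subseteq> E'" "E' \<subseteq> K_edges n"
  shows "blocked n q E - E' \<subseteq> blocked n q E'"
proof
  fix f assume f: "f \<in> blocked n q E - E'"
  have nb: "nbhd E v \<subseteq> nbhd E' v" for v
    using assms(1) by (auto simp: nbhd_def)
  then have "card (nbhd E v) \<le> card (nbhd E' v)" for v
    using finite_nbhd[OF assms(2)] by (intro card_mono)
  then have "q < card (nbhd E' v)" if "q < card (nbhd E v)" for v
    using that by (rule less_le_trans[rotated])
  with f nb show "f \<in> blocked n q E'"
    unfolding blocked_def by blast
qed

text \<open>The invariant of Maker's graph under Breaker's strategy. Coinciding \<open>a\<close>,
  \<open>b\<close>, \<open>c\<close> do no harm in the triangle clause, as singletons are not
  edges.\<close>

definition safe :: "nat \<Rightarrow> nat \<Rightarrow> edge set \<Rightarrow> bool" where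
  "safe n q E \<longleftrightarrow> E \<subseteq> K_edges n \<and> (\<forall>v. card (nbhd E v) \<le> Suc q) \<and>
     (\<forall>a b c. {a, b} \<in> E \<longrightarrow> {a, c} \<in> E \<longrightarrow> {b, c} \<notin> E)"

text \<open>The ends of an unblocked edge have degree at most \<open>q\<close>, which leaves room
  for one more edge, and no common neighbour, so no triangle arises.\<close>

lemma safe_insert:
  assumes E: "safe n q E" and e: "e \<in> K_edges n" "e \<notin> E" "e \<notin> blocked n q E"
  shows "safe n q (insert e E)"
proof -
  obtain x y where xy: "e = {x, y}" "x \<noteq> y" using e(1) by (auto elim: nsets2_E)
  have sub: "E \<subseteq> K_edges n" using E by (simp add: safe_def)
  have unsat: "card (nbhd E v) \<le> q" if "v \<in> e" for v
    using e that by (fastforce simp: blocked_def)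
  have closed: "{u, w} \<noteq> e" if "{c, u} \<in> E" "{c, w} \<in> E" for c u w
    using e that by (auto simp: blocked_def nbhd_def)
  have deg: "card (nbhd (insert e E) v) \<le> Suc q" for v
  proof (cases "v \<in> e")
    case True
    then obtain w where w: "nbhd (insert e E) v \<subseteq> insert w (nbhd E v)"
      using xy by (auto simp: nbhd_def doubleton_eq_iff)
    then have "card (nbhd (insert e E) v) \<le> card (insert w (nbhd E v))"
      using finite_nbhd[OF sub] by (intro card_mono) auto
    also have "\<dots> \<le> Suc (card (nbhd E v))" by (rule card_insert_le_m1) auto
    finally show ?thesis using unsat[OF True] by simp
  next
    case False
    then have "nbhd (insert e E) v = nbhd E v" by (auto simp: nbhd_def)
    then show ?thesis using E by (simp add: safe_def)
  qed
  have free: "{b, c} \<notin> insert e E"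
    if abc: "{a, b} \<in> insert e E" "{a, c} \<in> insert e E" for a b c
  proof
    assume bc: "{b, c} \<in> insert e E"
    have "insert e E \<subseteq> K_edges n" using sub e(1) by simp
    then have "{a, b} \<in> K_edges n" "{a, c} \<in> K_edges n" "{b, c} \<in> K_edges n"
      using that bc by blast+
    then have "a \<noteq> b" "a \<noteq> c" "b \<noteq> c" by auto
    then have neq: "{a, b} \<noteq> {a, c}" "{a, b} \<noteq> {b, c}" "{a, c} \<noteq> {b, c}"
      by (auto simp: doubleton_eq_iff)
    \<comment> \<open>The three sides differ, so at most one of them is \<open>e\<close>; if one is,
      \<open>closed\<close> at the vertex opposite to it gives the contradiction.\<close>
    then consider "{a, b} = e" "{a, c} \<in> E" "{b, c} \<in> E" | "{a, c} = e" "{a, b} \<in> E" "{b, c} \<in> E"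
      | "{b, c} = e" "{a, b} \<in> E" "{a, c} \<in> E" | "{a, b} \<in> E" "{a, c} \<in> E" "{b, c} \<in> E"
      using abc bc by (metis insert_iff)
    then show False
    proof cases
      case 1
      then show False using closed[of c a b] by (simp add: insert_commute)
    next
      case 2
      then show False using closed[of b a c] by (simp add: insert_commute)
    next
      case 3
      then show False using closed[of a b c] by simp
    next
      case 4
      then show False using E unfolding safe_def by blast
    qed
  qed
  have "insert e E \<subseteq> K_edges n" using sub e(1) by simp
  then show ?thesis
    unfolding safe_def using deg free by iprover
qed

lemma safe_not_maker_wins:
  assumes "safe n q (maker_edges h)"
  shows "\<not> maker_wins n h"
proof
  assume "maker_wins n h"
  then obtain T where T: "card T = 3" "[T]\<^bsup>2\<^esup> \<subseteq> maker_edges h"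
    by (auto simp: maker_wins_def nsets_def)
  then obtain a b c where "T = {a, b, c}" "a \<noteq> b" "b \<noteq> c" "a \<noteq> c"
    by (auto simp: card_3_iff)
  then have "{a, b} \<in> maker_edges h" "{a, c} \<in> maker_edges h" "{b, c} \<in> maker_edges h"
    using T(2) by (auto intro!: subsetD[OF T(2)])
  then show False using assms unfolding safe_def by blast
qed

lemma maker_edges_simps [simp]:
  "maker_edges [] = {}" "maker_edges (h @ [(e, S)]) = insert e (maker_edges h)"
  by (auto simp: maker_edges_def)

lemma breaker_edges_simps [simp]:
  "breaker_edges [] = {}" "breaker_edges (h @ [(e, S)]) = breaker_edges h \<union> S"
  by (auto simp: breaker_edges_def)

lemma follows_Nil: "follows \<sigma> []"
  by (simp add: follows_def)

lemma follows_snoc: "follows \<sigma> (h @ [(e, S)]) \<longleftrightarrow> follows \<sigma> h \<and> S = \<sigma> h e"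
  by (auto simp: follows_def less_Suc_eq nth_append)

lemma finite_maker_edges: "finite (maker_edges h)"
  by (simp add: maker_edges_def)

lemma legal_play_budget:
  "legal_play n q h \<Longrightarrow> card (breaker_edges h) \<le> q * card (maker_edges h)"
  by (induction rule: legal_play.induct) (auto simp: legal_reply_def)

lemma breaker_has_winning_strategyI:
  assumes n: "n - 1 \<le> (q + 2) choose 2"
  shows "breaker_has_winning_strategy n q"
proof -
  define R where "R h e = blocked n q (insert e (maker_edges h)) - breaker_edges h" for h e
  \<comment> \<open>A strategy must reply legally to every legal history, even one that it would
    never produce and where \<open>R h e\<close> may exceed the budget. The empty reply is a legal
    default.\<close>
  define \<sigma> where "\<sigma> h e = (if legal_reply n q h e (R h e) then R h e else {})" for h e
  have "legal_reply n q h e {}" if "legal_play n q h" for h e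
  proof -
    have "card (breaker_edges h) \<le> q * card (maker_edges h)"
      using that by (rule legal_play_budget)
    also have "\<dots> \<le> q * card (insert e (maker_edges h))"
      using finite_maker_edges by (intro mult_le_mono2 card_mono) auto
    finally show ?thesis by (simp add: legal_reply_def)
  qed
  then have strat: "breaker_strategy n q \<sigma>"
    by (auto simp: breaker_strategy_def \<sigma>_def)
  \<comment> \<open>Equality matters in both directions: Breaker owning all blocked edges keeps
    Maker safe, and his owning no others keeps him within the budget.\<close>
  have inv: "follows \<sigma> h \<longrightarrow>
      safe n q (maker_edges h) \<and> breaker_edges h = blocked n q (maker_edges h)"
    if "legal_play n q h" for h
    using that
  proof (induction rule: legal_play.induct)
    case start
    show ?case by (auto simp: safe_def blocked_def nbhd_def nsets_def)
  next
    case (round h e S)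
    show ?case
    proof
      assume "follows \<sigma> (h @ [(e, S)])"
      then have S: "S = \<sigma> h e" and IH: "safe n q (maker_edges h)"
          "breaker_edges h = blocked n q (maker_edges h)"
        using round.IH by (auto simp: follows_snoc)
      let ?E = "insert e (maker_edges h)"
      have e: "e \<in> K_edges n" "e \<notin> maker_edges h" "e \<notin> blocked n q (maker_edges h)"
        using round.hyps(2) IH(2) by (auto simp: unclaimed_def)
      have safe: "safe n q ?E" using IH(1) e by (rule safe_insert)
      have "breaker_edges h \<subseteq> blocked n q ?E"
        using blocked_mono[of "maker_edges h" ?E n q] safe e(3) IH(2)
        by (auto simp: safe_def blocked_def)
      then have un: "breaker_edges h \<union> R h e = blocked n q ?E"
        by (auto simp: R_def)
      have "card (blocked n q ?E) \<le> q * card ?E"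
        using safe n by (intro card_blocked_le) (auto simp: safe_def)
      then have "legal_reply n q h e (R h e)"
        unfolding legal_reply_def un by (auto simp: R_def unclaimed_def blocked_def)
      then show "safe n q (maker_edges (h @ [(e, S)])) \<and>
          breaker_edges (h @ [(e, S)]) = blocked n q (maker_edges (h @ [(e, S)]))"
        using S safe un by (simp add: \<sigma>_def)
    qed
  qed
  have "breaker_wins n h" if "legal_play n q h" "follows \<sigma> h" "unclaimed n h = {}" for h
    using that inv safe_not_maker_wins breaker_wins_iff_not_maker_wins by blast
  then show ?thesis using strat by (auto simp: breaker_has_winning_strategy_def)
qed

section \<open>Maker's strategy\<close>

lemma play_round:
  assumes "breaker_strategy n q \<sigma>" "legal_play n q h" "follows \<sigma> h" "e \<in> unclaimed n h"
  shows "legal_play n q (h @ [(e, \<sigma> h e)])" "follows \<sigma> (h @ [(e, \<sigma> h e)])"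
proof -
  have "legal_reply n q h e (\<sigma> h e)"
    using assms(1,2,4) by (simp add: breaker_strategy_def)
  then show "legal_play n q (h @ [(e, \<sigma> h e)])"
    using assms(2,4) by (rule legal_play.round[rotated 2])
  show "follows \<sigma> (h @ [(e, \<sigma> h e)])"
    using assms(3) by (simp add: follows_snoc)
qed

text \<open>Winning is judged on finished plays only. Any unclaimed edge may serve as Maker's next
  one, since a triangle once owned is never lost.\<close>

lemma complete_play:
  assumes "breaker_strategy n q \<sigma>" "legal_play n q h" "follows \<sigma> h"
  shows "\<exists>h'. legal_play n q h' \<and> follows \<sigma> h' \<and> unclaimed n h' = {} \<and>
    maker_edges h \<subseteq> maker_edges h'"
  using assms(2,3)
proof (induction "card (unclaimed n h)" arbitrary: h rule: less_induct)
  case less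
  show ?case
  proof (cases "unclaimed n h = {}")
    case True
    then show ?thesis using less.prems by blast
  next
    case False
    then obtain e where e: "e \<in> unclaimed n h" by blast
    let ?h = "h @ [(e, \<sigma> h e)]"
    have "unclaimed n ?h \<subset> unclaimed n h"
      using e by (auto simp: unclaimed_def)
    then have "card (unclaimed n ?h) < card (unclaimed n h)"
      using finite_K_edges by (intro psubset_card_mono) (auto simp: unclaimed_def)
    from less.hyps[OF this play_round[OF assms(1) less.prems e]] show ?thesis by auto
  qed
qed

text \<open>The bound on \<open>m\<close> is quadratic in \<open>d\<close> and largest at
  \<open>d = q + 1\<close> and \<open>d = q + 2\<close>, where it equals
  \<open>(q + 2) choose 2\<close>.\<close>

lemma budget_star_bound:
  fixes d q m :: nat
  assumes "(d choose 2) + (m - d) \<le> q * d"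
  shows "m \<le> (q + 2) choose 2"
proof -
  have c: "2 * int (k choose 2) = int k * (int k - 1)" for k
    using arg_cong[OF two_times_choose_two, of int k] by (cases k) (simp_all add: algebra_simps)
  have "int (d choose 2) + int m - int d \<le> int q * int d"
  proof -
    have "int (d choose 2) + int (m - d) \<le> int q * int d"
      using assms by (metis of_nat_add of_nat_le_iff of_nat_mult)
    \<comment> \<open>This also holds when \<open>d\<close> exceeds \<open>m\<close> and the natural
      subtraction truncates to 0.\<close>
    moreover have "int m - int d \<le> int (m - d)" by linarith
    ultimately show ?thesis by linarith
  qed
  then have "2 * int m \<le> 2 * int q * int d + 2 * int d - int d * (int d - 1)"
    using c[of d] by linarith
  \<comment> \<open>The difference of the two sides is the product of the consecutive integers \<open>q + 1 - d\<close>
    and \<open>q + 2 - d\<close>.\<close>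
  also have "\<dots> \<le> (int q + 2) * (int q + 1)"
  proof -
    have "0 \<le> (int q + 1 - int d) * (int q + 2 - int d)"
      by (cases "int d \<le> int q + 1") (auto intro: mult_nonneg_nonneg mult_nonpos_nonpos)
    then show ?thesis by (simp add: algebra_simps)
  qed
  also have "\<dots> = 2 * int ((q + 2) choose 2)"
    using c[of "q + 2"] by (simp add: algebra_simps)
  finally show ?thesis by simp
qed

text \<open>With \<open>\<sigma>\<close> fixed, Maker's side takes the form of suitable plays that
  follow \<open>\<sigma>\<close>, rather than a strategy function. A largest reachable star replaces
  the step-by-step growth.\<close>

lemma breaker_has_winning_strategyD:
  assumes n: "n > 0" and win: "breaker_has_winning_strategy n q"
  shows "n - 1 \<le> (q + 2) choose 2"
proof -
  obtain \<sigma> where \<sigma>: "breaker_strategy n q \<sigma>"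
    and wins: "\<And>h. legal_play n q h \<Longrightarrow> follows \<sigma> h \<Longrightarrow> unclaimed n h = {} \<Longrightarrow> breaker_wins n h"
    using win by (auto simp: breaker_has_winning_strategy_def)
  have no_triangle: "\<not> maker_wins n h" if h: "legal_play n q h" "follows \<sigma> h" for h
  proof
    assume "maker_wins n h"
    moreover obtain h' where h': "legal_play n q h'" "follows \<sigma> h'" "unclaimed n h' = {}"
        "maker_edges h \<subseteq> maker_edges h'"
      using complete_play[OF \<sigma> h] by blast
    ultimately have "maker_wins n h'" by (auto simp: maker_wins_def)
    then show False using wins h' breaker_wins_iff_not_maker_wins by blast
  qed
  \<comment> \<open>The star is centred at vertex 0, and \<open>V\<close> holds its
    \<open>n - 1\<close> possible leaves.\<close>
  define V where "V = {1..<n}"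
  define star :: "nat set \<Rightarrow> edge set" where "star D = (\<lambda>u. {0, u}) ` D" for D
  have inj: "inj_on (\<lambda>u. {0::nat, u}) D" for D
    by (auto simp: inj_on_def doubleton_eq_iff)
  define P where "P D \<longleftrightarrow> D \<subseteq> V \<and>
      (\<exists>h. legal_play n q h \<and> follows \<sigma> h \<and> maker_edges h = star D)" for D
  have "P {}" using legal_play.start follows_Nil by (fastforce simp: P_def star_def)
  moreover have "finite {D. P D}"
    by (rule finite_subset[of _ "Pow V"]) (auto simp: P_def V_def)
  ultimately obtain D where D: "P D" and max: "\<And>D'. P D' \<Longrightarrow> D \<subseteq> D' \<Longrightarrow> D' = D"
    using finite_has_maximal[of "{D. P D}"] by blast
  obtain h where h: "legal_play n q h" "follows \<sigma> h" and M: "maker_edges h = star D"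
    and DV: "D \<subseteq> V"
    using D by (auto simp: P_def)
  have finD: "finite D" using DV finite_subset by (auto simp: V_def)
  \<comment> \<open>Otherwise Maker could claim one more ray, against the maximality of
    \<open>D\<close>.\<close>
  have "star (V - D) \<subseteq> breaker_edges h"
  proof
    fix f assume "f \<in> star (V - D)"
    then obtain u where u: "f = {0, u}" "u \<in> V" "u \<notin> D" by (auto simp: star_def)
    show "f \<in> breaker_edges h"
    proof (rule ccontr)
      assume "f \<notin> breaker_edges h"
      moreover have "f \<notin> star D" using u by (auto simp: star_def doubleton_eq_iff)
      ultimately have "f \<in> unclaimed n h"
        using u M by (auto simp: unclaimed_def V_def)
      from play_round[OF \<sigma> h this] have "P (insert u D)"
        unfolding P_def using DV u M by (intro conjI exI[of _ "h @ [(f, \<sigma> h f)]"]) (auto simp: star_def)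
      then show False using max u by blast
    qed
  qed
  \<comment> \<open>Otherwise Maker could join two leaves and close a triangle through 0.\<close>
  moreover have "[D]\<^bsup>2\<^esup> \<subseteq> breaker_edges h"
  proof
    fix f assume "f \<in> [D]\<^bsup>2\<^esup>"
    then obtain u w where f: "f = {u, w}" "u \<noteq> w" "u \<in> D" "w \<in> D" by (auto elim: nsets2_E)
    have uw: "0 < u" "u < n" "0 < w" "w < n" using f(3,4) DV unfolding V_def by force+
    show "f \<in> breaker_edges h"
    proof (rule ccontr)
      assume "f \<notin> breaker_edges h"
      moreover have "f \<notin> star D" using f uw by (auto simp: star_def doubleton_eq_iff)
      ultimately have "f \<in> unclaimed n h"
        using f uw M by (auto simp: unclaimed_def)
      note play = play_round[OF \<sigma> h this]
      have "{0, u, w} \<in> K_triangles n"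
        using f uw n by (auto simp: nsets_def card_insert_if)
      moreover have "[{0, u, w}]\<^bsup>2\<^esup> \<subseteq> insert f (star D)"
        using f by (auto simp: star_def insert_commute elim!: nsets2_E)
      ultimately have "maker_wins n (h @ [(f, \<sigma> h f)])"
        using M unfolding maker_wins_def by auto
      then show False using no_triangle play by blast
    qed
  qed
  moreover have "star (V - D) \<inter> [D]\<^bsup>2\<^esup> = {}"
    using DV by (auto simp: star_def V_def)
  moreover have "finite (breaker_edges h)"
    using legal_play_subset[OF h(1)] finite_K_edges finite_subset by blast
  ultimately have "card (star (V - D)) + card ([D]\<^bsup>2\<^esup>) \<le> card (breaker_edges h)"
    by (metis Un_least card_Un_disjoint card_mono finite_subset)
  moreover have "card (star (V - D)) = n - 1 - card D"
    using DV finD by (simp add: star_def card_image[OF inj] card_Diff_subset V_def)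
  moreover have "card (maker_edges h) = card D"
    by (simp add: M star_def card_image[OF inj])
  ultimately have "(card D choose 2) + (n - 1 - card D) \<le> q * card D"
    using legal_play_budget[OF h(1)] by (simp add: card_nsets)
  then show ?thesis by (rule budget_star_bound)
qed

section \<open>The threshold\<close>

text \<open>Completing the square: \<open>(q + 2) * (q + 1)\<close> is the square of
  \<open>q + 3 / 2\<close> minus \<open>1 / 4\<close>, and integrality absorbs the
  \<open>1 / 4\<close>.\<close>

lemma choose_two_bound_iff_sqrt:
  assumes "n \<ge> 1"
  shows "n - 1 \<le> (q + 2) choose 2 \<longleftrightarrow> sqrt (2 * real n - 2) - 3 / 2 \<le> real q"
proof -
  have c: "2 * ((q + 2) choose 2) = (q + 2) * (q + 1)"
    by (simp add: two_times_choose_two)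
  have "sqrt (2 * real n - 2) - 3 / 2 \<le> real q \<longleftrightarrow> sqrt (2 * real n - 2) \<le> real q + 3 / 2"
    by linarith
  also have "\<dots> \<longleftrightarrow> 2 * real n - 2 \<le> (real q + 3 / 2)\<^sup>2"
    using real_sqrt_le_iff[of _ "(real q + 3 / 2)\<^sup>2"] by simp
  also have "\<dots> \<longleftrightarrow> real (8 * (n - 1)) \<le> real (4 * ((q + 2) * (q + 1)) + 1)"
  proof -
    have "4 * (real q + 3 / 2)\<^sup>2 = real (4 * ((q + 2) * (q + 1)) + 1)"
      by (simp add: power2_eq_square algebra_simps)
    moreover have "4 * (2 * real n - 2) = real (8 * (n - 1))"
      using assms by (simp add: of_nat_diff)
    ultimately show ?thesis by linarith
  qed
  \<comment> \<open>Both \<open>8 * (n - 1)\<close> and \<open>4 * ((q + 2) * (q + 1))\<close> are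
    multiples of 8, so the added 1 changes nothing.\<close>
  also have "\<dots> \<longleftrightarrow> n - 1 \<le> (q + 2) choose 2"
    unfolding of_nat_le_iff c[symmetric] by presburger
  finally show ?thesis by simp
qed

theorem theorem1p3:
  fixes n :: nat
  assumes "n \<ge> 3"
  shows "int (threshold_bias n) = \<lceil>sqrt (2 * real n - 2) - 3 / 2\<rceil>"
proof -
  define x where "x = sqrt (2 * real n - 2) - 3 / 2"
  have iff: "breaker_has_winning_strategy n q \<longleftrightarrow> x \<le> real q" for q
    using breaker_has_winning_strategyI[of n q] breaker_has_winning_strategyD[of n q]
      choose_two_bound_iff_sqrt[of n q] assms
    unfolding x_def by auto
  \<comment> \<open>From \<open>n \<ge> 3\<close> it follows that \<open>x\<close> is positive, so
    \<open>nat\<close> does not truncate its ceiling.\<close>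
  have "2 \<le> sqrt (2 * real n - 2)"
    using assms by (intro real_le_rsqrt) simp
  then have "0 \<le> \<lceil>x\<rceil>" by (simp add: x_def)
  moreover have "threshold_bias n = nat \<lceil>x\<rceil>"
    unfolding threshold_bias_def iff by (rule Least_equality) linarith+
  ultimately show ?thesis by (simp add: x_def)
qed

end
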